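(* Let $g:[0,1]\to\mathbb{R}$ be a strictly decreasing $C^1$ function with $g(0)=1$ and $g(1)=0$. For each $n\in\mathbb{N}_+$ let $\sigma_n\sim\mathrm{PERM}(g,n)$ be a $g$-random permutation of $[n]$, and let $F_{\sigma_n}$ be the (random) joint c.d.f. of the (random) permuton $\mu_{\sigma_n}$ associated with $\sigma_n$. Then for every $x,y\in[0,1]$, $$F_{\sigma_n}(x,y)\stackrel{\mathbb{P}}{\longrightarrow}F_g(x,y)\qquad\text{as } n\to\infty,$$ where $F_g$ is the deterministic c.d.f. of the permuton arising from $g$, and $\stackrel{\mathbb{P}}{\longrightarrow}$ denotes convergence in probability.
   Context: $[n]=\{1,\dots,n\}$ and $S_n$ is the set of permutations of $[n]$. A permuton is a probability measure on $[0,1]^2$ both of whose marginals are uniform on $[0,1]$. **$g$-random permutation.** Let $g$ be a strictly decreasing $C^1[0,1]$ function with $g(0)=1$, $g(1)=0$. For $n\in\mathbb{N}_+$ and $i\in[n]$ let $\nu_g^{(n),i}$ be the probability distribution on $[n-(i-1)]$ with $$\nu_g^{(n),i}(\{l\})=\frac{g\left(\frac{(i-1)+(l-1)}{n}\right)-g\left(\frac{(i-1)+l}{n}\right)}{g\left(\frac{i-1}{n}\right)},\qquad l=1,\dots,n-(i-1).$$ Let $C^{(n),i}$, $i\in[n]$, be independent with $C^{(n),i}\sim\nu_g^{(n),i}$. Define recursively $D^{(n)}_1=[n]$; given $D^{(n)}_i$ (a set of size $n-(i-1)$), let $\sigma_n(i)$ be the $C^{(n),i}$-th smallest element of $D^{(n)}_i$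 and $D^{(n)}_{i+1}=D^{(n)}_i\setminus\{\sigma_n(i)\}$. The law of the resulting random permutation $\sigma_n\in S_n$ is denoted $\mathrm{PERM}(g,n)$. **Permutations as permutons.** For $\sigma\in S_n$, $\mu_\sigma$ is the permuton with density $f_\sigma(x,y)=n\cdot\mathbf{1}[\sigma(\lceil nx\rceil)=\lceil ny\rceil]$ for $(x,y)\in(0,1]^2$ (and zero otherwise), and $F_\sigma$ is its joint c.d.f. **The limiting permuton.** Let $u(x)=\int_0^x\frac{1}{g(z)}\,dz$ for $x\in[0,1)$ (one has $u(x)\to+\infty$ as $x\to1_-$), and define $V_g(x,y)=u^{-1}(u(x)+u(y))$ for $(x,y)\in[0,1)^2$ (equivalently, $V_g(\cdot,y)$ is the unique solution of $V_g(0,y)=y$, $\partial_xV_g(x,y)=g(V_g(x,y))/g(x)$), extended to $[0,1]^2$ by $V_g(1,y)=V_g(x,1)=1$. Let $F_g(x,y)=x+y-V_g(x,y)$. $F_g$ is the joint c.d.f. of a permuton, denoted $\mu_g$. *)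

theory Defs
  imports "HOL-Probability.Probability" "HOL-Combinatorics.Permutations"
begin

text \<open>At boundary points of \<open>S\<close> the derivative is one-sided: the derivative is taken within \<open>S\<close>,
  unlike in \<^const>\<open>C1_differentiable_on\<close>, which would also restrict \<open>g\<close> outside \<open>S\<close>.\<close>

definition C1_on :: "real set \<Rightarrow> (real \<Rightarrow> real) \<Rightarrow> bool" where
  "C1_on S g \<longleftrightarrow>
     (\<exists>g'. continuous_on S g' \<and> (\<forall>x\<in>S. (g has_real_derivative g' x) (at x within S)))"


subsection \<open>The \<open>g\<close>-random permutation\<close>

definition nu_mass :: "(real \<Rightarrow> real) \<Rightarrow> nat \<Rightarrow> nat \<Rightarrow> nat \<Rightarrow> real" where
  "nu_mass g n i l =
     (if l \<in> {1..n - (i - 1)}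
      then (g ((real (i - 1) + real (l - 1)) / real n) - g ((real (i - 1) + real l) / real n))
             / g (real (i - 1) / real n)
      else 0)"

definition nu :: "(real \<Rightarrow> real) \<Rightarrow> nat \<Rightarrow> nat \<Rightarrow> nat pmf" where
  "nu g n i = embed_pmf (nu_mass g n i)"

text \<open>The \<open>l\<close>-th smallest element of a finite set, counting from \<open>1\<close>.\<close>

definition kth_smallest :: "nat \<Rightarrow> nat set \<Rightarrow> nat" where
  "kth_smallest l D = sorted_list_of_set D ! (l - 1)"

text \<open>\<open>avail n c k\<close> is the set \<open>D\<^sub>k\<^sub>+\<^sub>1\<close> of values still available after \<open>k\<close> steps, when the
  ranks chosen are \<open>c 1, c 2, \<dots>\<close>.\<close>

primrec avail :: "nat \<Rightarrow> (nat \<Rightarrow> nat) \<Rightarrow> nat \<Rightarrow> nat set" where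
  "avail n c 0 = {1..n}"
| "avail n c (Suc k) = avail n c k - {kth_smallest (c (Suc k)) (avail n c k)}"

text \<open>Permutations of \<open>{1..n}\<close> are represented, as in \<^const>\<open>permutes\<close>, by functions that are the
  identity outside \<open>{1..n}\<close>.\<close>

definition perm_of_ranks :: "nat \<Rightarrow> (nat \<Rightarrow> nat) \<Rightarrow> nat \<Rightarrow> nat" where
  "perm_of_ranks n c i =
     (if i \<in> {1..n} then kth_smallest (c i) (avail n c (i - 1)) else i)"

definition PERM :: "(real \<Rightarrow> real) \<Rightarrow> nat \<Rightarrow> (nat \<Rightarrow> nat) pmf" where
  "PERM g n = map_pmf (perm_of_ranks n) (Pi_pmf {1..n} 0 (nu g n))"


subsection \<open>Permutations as permutons\<close>

definition perm_density :: "nat \<Rightarrow> (nat \<Rightarrow> nat) \<Rightarrow> real \<times> real \<Rightarrow> real" where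
  "perm_density n \<sigma> = (\<lambda>(x, y).
     if x \<in> {0<..1} \<and> y \<in> {0<..1} \<and> \<sigma> (nat \<lceil>real n * x\<rceil>) = nat \<lceil>real n * y\<rceil>
     then real n else 0)"

definition perm_permuton :: "nat \<Rightarrow> (nat \<Rightarrow> nat) \<Rightarrow> (real \<times> real) measure" where
  "perm_permuton n \<sigma> = density lborel (\<lambda>p. ennreal (perm_density n \<sigma> p))"

definition joint_cdf :: "(real \<times> real) measure \<Rightarrow> real \<Rightarrow> real \<Rightarrow> real" where
  "joint_cdf \<mu> x y = measure \<mu> ({..x} \<times> {..y})"

definition F_perm :: "nat \<Rightarrow> (nat \<Rightarrow> nat) \<Rightarrow> real \<Rightarrow> real \<Rightarrow> real" where
  "F_perm n \<sigma> = joint_cdf (perm_permuton n \<sigma>)"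


subsection \<open>The limiting permuton\<close>

definition u_fun :: "(real \<Rightarrow> real) \<Rightarrow> real \<Rightarrow> real" where
  "u_fun g x = integral {0..x} (\<lambda>z. 1 / g z)"

definition V_lim :: "(real \<Rightarrow> real) \<Rightarrow> real \<Rightarrow> real \<Rightarrow> real" where
  "V_lim g x y =
     (if x = 1 \<or> y = 1 then 1
      else the_inv_into {0..<1} (u_fun g) (u_fun g x + u_fun g y))"

definition F_lim :: "(real \<Rightarrow> real) \<Rightarrow> real \<Rightarrow> real \<Rightarrow> real" where
  "F_lim g x y = x + y - V_lim g x y"


subsection \<open>Convergence in probability to a constant\<close>

text \<open>The random variables \<open>X n\<close> may live on different probability spaces \<open>M n\<close>.\<close>

definition tendsto_in_prob :: "(nat \<Rightarrow> 'a measure) \<Rightarrow> (nat \<Rightarrow> 'a \<Rightarrow> real) \<Rightarrow> real \<Rightarrow> bool" where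
  "tendsto_in_prob M X c \<longleftrightarrow>
     (\<forall>\<epsilon>>0. (\<lambda>n. measure (M n) {\<omega> \<in> space (M n). \<bar>X n \<omega> - c\<bar> > \<epsilon>}) \<longlonglongrightarrow> 0)"


subsection \<open>Well-definedness of the law\<close>

lemma pmf_nu:
  assumes g: "strict_antimono_on {0..1} g" "g 1 = 0" and i: "i \<in> {1..n}"
  shows "pmf (nu g n i) l = nu_mass g n i l"
proof -
  have n: "n > 0" using i by auto
  define a where "a = i - 1"
  have a: "a < n" using i by (auto simp: a_def)
  have dec: "g y \<le> g x" if "0 \<le> x" "x \<le> y" "y \<le> 1" for x y
    using that monotone_onD[OF g(1), of x y] by (cases "x = y") auto
  have pos: "g (real a / real n) > 0"
    using monotone_onD[OF g(1), of "real a / real n" 1] a g(2) by auto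
  have nonneg: "nu_mass g n i l \<ge> 0" for l
  proof (cases "l \<in> {1..n - a}")
    case True
    then have "(real a + real l) / real n \<le> 1"
      using a n by (auto simp: divide_le_eq_1 of_nat_add[symmetric] simp del: of_nat_add)
    moreover have "(real a + real (l - 1)) / real n \<le> (real a + real l) / real n"
      by (intro divide_right_mono) auto
    ultimately show ?thesis
      using pos dec[of "(real a + real (l - 1)) / real n" "(real a + real l) / real n"]
      by (auto simp: nu_mass_def a_def)
  next
    case False
    then show ?thesis by (auto simp: nu_mass_def a_def)
  qed
  have "(\<Sum>l\<in>{1..n - a}. nu_mass g n i l)
      = (\<Sum>l\<in>{1..n - a}. (g ((real a + real (l - 1)) / real n)
            - g ((real a + real l) / real n))) / g (real a / real n)"
    by (simp add: nu_mass_def a_def sum_divide_distrib)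
  also have "(\<Sum>l\<in>{1..n - a}. (g ((real a + real (l - 1)) / real n)
            - g ((real a + real l) / real n)))
      = (\<Sum>l<n - a. g ((real a + real l) / real n) - g ((real a + real (Suc l)) / real n))"
    by (rule sum.reindex_bij_witness[of _ Suc "\<lambda>l. l - 1"]) auto
  also have "\<dots> = g (real a / real n)"
    using sum_lessThan_telescope'[of "\<lambda>l. g ((real a + real l) / real n)" "n - a"] a n g(2)
    by (simp add: of_nat_diff)
  finally have sum1: "(\<Sum>l\<in>{1..n - a}. nu_mass g n i l) = 1" using pos by simp
  have "(\<integral>\<^sup>+l. ennreal (nu_mass g n i l) \<partial>count_space UNIV)
      = (\<Sum>l\<in>{1..n - a}. ennreal (nu_mass g n i l))"
    by (rule nn_integral_count_space') (auto simp: nu_mass_def a_def)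
  also have "\<dots> = 1" using sum1 nonneg by (simp add: sum_ennreal)
  finally show ?thesis unfolding nu_def by (intro pmf_embed_pmf nonneg)
qed

lemma kth_smallest_in:
  assumes "finite D" "l \<in> {1..card D}"
  shows "kth_smallest l D \<in> D"
  using assms nth_mem[of "l - 1" "sorted_list_of_set D"] by (auto simp: kth_smallest_def)

lemma perm_of_ranks_permutes:
  assumes c: "\<And>i. i \<in> {1..n} \<Longrightarrow> c i \<in> {1..n - (i - 1)}"
  shows "perm_of_ranks n c permutes {1..n}"
proof -
  have card: "k \<le> n \<Longrightarrow> finite (avail n c k) \<and> card (avail n c k) = n - k" for k
  proof (induction k)
    case (Suc k)
    then have "kth_smallest (c (Suc k)) (avail n c k) \<in> avail n c k"
      using c[of "Suc k"] by (intro kth_smallest_in) auto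
    then show ?case using Suc by auto
  qed auto
  have dec: "j \<le> k \<Longrightarrow> avail n c k \<subseteq> avail n c j" for j k
    by (induction k) (auto simp: le_Suc_eq)
  have mem: "perm_of_ranks n c i \<in> avail n c (i - 1) \<and> perm_of_ranks n c i \<notin> avail n c i"
    if i: "i \<in> {1..n}" for i
  proof -
    obtain k where k: "i = Suc k" using i by (cases i) auto
    then have "kth_smallest (c i) (avail n c k) \<in> avail n c k"
      using c[OF i] card[of k] i by (intro kth_smallest_in) auto
    then show ?thesis using i by (auto simp: k perm_of_ranks_def)
  qed
  have ne: "perm_of_ranks n c i \<noteq> perm_of_ranks n c j"
    if "i \<in> {1..n}" "j \<in> {1..n}" "i < j" for i j
  proof -
    have "i \<le> j - 1" using that by simp
    from dec[OF this] show ?thesis using mem[OF that(1)] mem[OF that(2)] by auto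
  qed
  have inj: "inj_on (perm_of_ranks n c) {1..n}"
    using ne by (intro linorder_inj_onI') blast
  moreover have "perm_of_ranks n c ` {1..n} \<subseteq> {1..n}"
    using mem dec[of 0] by fastforce
  ultimately have "bij_betw (perm_of_ranks n c) {1..n} {1..n}"
    by (metis bij_betw_def endo_inj_surj finite_atLeastAtMost)
  then show ?thesis
    by (rule bij_imp_permutes) (auto simp: perm_of_ranks_def)
qed

lemma set_pmf_PERM:
  assumes g: "strict_antimono_on {0..1} g" "g 1 = 0"
  shows "set_pmf (PERM g n) \<subseteq> {\<sigma>. \<sigma> permutes {1..n}}"
proof -
  have "c i \<in> {1..n - (i - 1)}"
    if c: "c \<in> set_pmf (Pi_pmf {1..n} 0 (nu g n))" and i: "i \<in> {1..n}" for c i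
  proof -
    have "c i \<in> set_pmf (nu g n i)"
      using c i by (auto simp: set_Pi_pmf PiE_dflt_def)
    then show ?thesis
      using pmf_nu[OF g i, of "c i"] by (auto simp: set_pmf_iff nu_mass_def split: if_splits)
  qed
  then show ?thesis
    unfolding PERM_def set_map_pmf by (blast intro: perm_of_ranks_permutes)
qed

end

theory Submission
  imports Defs
begin

text \<open>
  Fix a threshold \<open>m = \<lfloor>n y\<rfloor>\<close> and let \<open>A\<^sub>k\<close> be the number of values at most \<open>m\<close> still available
  after \<open>k\<close> steps. The telescoping masses of \<open>nu\<close> make \<open>W\<^sub>k = (k + A\<^sub>k) / n\<close> a Markov chain that jumps
  by \<open>1/n\<close> with probability \<open>g(W\<^sub>k) / g(k/n)\<close>, which is a stochastic Euler scheme for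
  \<open>\<partial>\<^sub>x V = g(V) / g(x)\<close>, and \<open>F\<close> at \<open>(k/n, m/n)\<close> is \<open>k/n + m/n - W\<^sub>k\<close>. Because \<open>g\<close> is decreasing,
  the drift is contracting, so the mean square of \<open>W\<^sub>k - V(k/n, y)\<close> grows by only \<open>O(1/n\<^sup>2)\<close> per step
  as long as \<open>k/n \<le> x < 1\<close>; Chebyshev's inequality concludes. The Euler error is controlled without
  differentiating \<open>V\<close>: by monotonicity of \<open>g\<close>, \<open>(b - a)/g(a) \<le> u(b) - u(a) \<le> (b - a)/g(b)\<close>.
\<close>

subsection \<open>Ranks and available values\<close>

text \<open>In the sorted list the values at most \<open>m\<close> occupy an initial segment of the
  positions. This turns the event that a step picks a value at most \<open>m\<close> into a bound on
  the rank alone.\<close>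

lemma kth_smallest_le_iff:
  assumes "finite D" and l: "l \<in> {1..card D}"
  shows "kth_smallest l D \<le> m \<longleftrightarrow> l \<le> card (D \<inter> {..m})"
proof -
  define xs where "xs = sorted_list_of_set D"
  have len: "length xs = card D" and set: "set xs = D" and dist: "distinct xs"
    using assms by (auto simp: xs_def)
  have mono: "xs ! i \<le> xs ! j" if "i \<le> j" "j < length xs" for i j
    using that by (simp add: xs_def sorted_nth_mono)
  define J where "J = {j. j < length xs \<and> xs ! j \<le> m}"
  have "D \<inter> {..m} = (!) xs ` J"
    using set by (auto simp: J_def in_set_conv_nth)
  moreover have "inj_on ((!) xs) J"
    using dist by (intro inj_on_nth) (auto simp: J_def)
  ultimately have cardJ: "card (D \<inter> {..m}) = card J"
    by (simp add: card_image)
  have fin: "finite J" by (simp add: J_def)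
  show ?thesis
  proof (cases "xs ! (l - 1) \<le> m")
    case True
    have "{..<l} \<subseteq> J"
    proof
      fix j assume j: "j \<in> {..<l}"
      then have "xs ! j \<le> xs ! (l - 1)" using l len by (intro mono) auto
      then show "j \<in> J" using True j l len by (auto simp: J_def)
    qed
    then have "l \<le> card J" using card_mono[OF fin, of "{..<l}"] by simp
    then show ?thesis using True cardJ by (simp add: kth_smallest_def xs_def)
  next
    case False
    have "J \<subseteq> {..<l - 1}"
    proof
      fix j assume j: "j \<in> J"
      show "j \<in> {..<l - 1}"
      proof (rule ccontr)
        assume "j \<notin> {..<l - 1}"
        then have "xs ! (l - 1) \<le> xs ! j" using j by (intro mono) (auto simp: J_def)
        then show False using j False by (auto simp: J_def)
      qed
    qed
    then have "card J \<le> l - 1" using card_mono[of "{..<l - 1}" J] by simp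
    then have "\<not> l \<le> card J" using l by auto
    then show ?thesis using False cardJ by (simp add: kth_smallest_def xs_def)
  qed
qed

lemma avail_cong:
  assumes "\<And>i. i \<in> {1..k} \<Longrightarrow> c i = c' i"
  shows "avail n c k = avail n c' k"
  using assms by (induction k) auto

lemma finite_avail: "finite (avail n c k)"
  by (induction k) auto

text \<open>Only the first \<open>k\<close> ranks are constrained, so the count also applies to rank
  sequences drawn from the partial product over \<open>{1..k}\<close>.\<close>

lemma card_avail:
  assumes "k \<le> n" "\<And>i. i \<in> {1..k} \<Longrightarrow> c i \<in> {1..n - (i - 1)}"
  shows "card (avail n c k) = n - k"
  using assms
proof (induction k)
  case (Suc k)
  then have "kth_smallest (c (Suc k)) (avail n c k) \<in> avail n c k"
    using Suc.prems(2)[of "Suc k"] by (intro kth_smallest_in finite_avail) auto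
  then show ?case using Suc by (auto simp: finite_avail)
qed auto

lemma avail_eq_Diff:
  assumes "k \<le> n"
  shows "avail n c k = {1..n} - perm_of_ranks n c ` {1..k}"
  using assms
proof (induction k)
  case (Suc k)
  have "{1..Suc k} = insert (Suc k) {1..k}" by auto
  then show ?case using Suc by (auto simp: perm_of_ranks_def)
qed auto

text \<open>A value at most \<open>m\<close> is either still available or was taken by exactly one
  of the first \<open>k\<close> positions. This links the counts behind the c.d.f. to the available
  values.\<close>

lemma card_avail_atMost:
  assumes c: "\<And>i. i \<in> {1..n} \<Longrightarrow> c i \<in> {1..n - (i - 1)}" and "k \<le> n" "m \<le> n"
  shows "card (avail n c k \<inter> {..m}) + card {i \<in> {1..k}. perm_of_ranks n c i \<le> m} = m"
proof -
  define \<sigma> where "\<sigma> = perm_of_ranks n c"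
  have perm: "\<sigma> permutes {1..n}" unfolding \<sigma>_def by (rule perm_of_ranks_permutes) (rule c)
  let ?I = "{i \<in> {1..k}. \<sigma> i \<le> m}"
  have sub: "\<sigma> ` ?I \<subseteq> {1..m}"
    using permutes_in_image[OF perm] \<open>k \<le> n\<close> by fastforce
  have "avail n c k \<inter> {..m} = {1..m} - \<sigma> ` ?I"
    using \<open>k \<le> n\<close> \<open>m \<le> n\<close> by (auto simp: avail_eq_Diff \<sigma>_def)
  then have "card (avail n c k \<inter> {..m}) = m - card (\<sigma> ` ?I)"
    using sub by (simp add: card_Diff_subset finite_subset)
  moreover have "card (\<sigma> ` ?I) = card ?I"
    using permutes_inj[OF perm] by (intro card_image) (auto intro: inj_on_subset)
  moreover have "card (\<sigma> ` ?I) \<le> m"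
    using card_mono[OF _ sub] by simp
  ultimately show ?thesis by (simp add: \<sigma>_def)
qed

subsection \<open>The joint c.d.f. of a permutation\<close>

text \<open>The fraction of the strip \<open>{(i - 1)/n<..i/n}\<close> that lies to the left of \<open>x\<close>.\<close>

definition overlap :: "nat \<Rightarrow> nat \<Rightarrow> real \<Rightarrow> real" where
  "overlap n i x = max 0 (min 1 (real n * x - (real i - 1)))"

text \<open>Open on the left and closed on the right, in agreement with the ceilings in
  \<open>perm_density\<close>.\<close>

definition cell :: "nat \<Rightarrow> nat \<Rightarrow> real set" where
  "cell n i = {(real i - 1) / real n <.. real i / real n}"

lemma cell_iff:
  assumes "i \<in> {1..n}"
  shows "x \<in> cell n i \<longleftrightarrow> x \<in> {0<..1} \<and> nat \<lceil>real n * x\<rceil> = i"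
proof -
  have n: "n > 0" using assms by auto
  have *: "x \<in> cell n i \<longleftrightarrow> \<lceil>real n * x\<rceil> = int i"
    using n by (auto simp: cell_def field_simps ceiling_eq_iff)
  have "x \<in> {0<..1}" if "x \<in> cell n i"
  proof -
    have "0 \<le> (real i - 1) / real n" "real i / real n \<le> 1"
      using assms n by (auto simp: divide_simps)
    then show ?thesis using that by (auto simp: cell_def)
  qed
  moreover have "nat z = i \<longleftrightarrow> z = int i" for z
    using assms by auto
  ultimately show ?thesis using * by auto
qed

lemma emeasure_cell_Int_atMost:
  assumes "n > 0"
  shows "emeasure lborel (cell n i \<inter> {..x}) = ennreal (overlap n i x / real n)"
proof (cases "(real i - 1) / real n \<le> x")
  case True
  have "cell n i \<inter> {..x} = {(real i - 1) / real n <.. min (real i / real n) x}"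
    by (auto simp: cell_def)
  moreover have "(real i - 1) / real n \<le> min (real i / real n) x"
    using True by (auto simp: divide_right_mono)
  moreover have "min (real i / real n) x - (real i - 1) / real n = overlap n i x / real n"
    using True assms by (auto simp: overlap_def min_def max_def field_simps)
  ultimately show ?thesis by simp
next
  case False
  then have "cell n i \<inter> {..x} = {}" by (auto simp: cell_def)
  moreover have "overlap n i x = 0"
    using False assms by (auto simp: overlap_def field_simps)
  ultimately show ?thesis by simp
qed

text \<open>The cells are pairwise disjoint, so at a point with first coordinate \<open>x\<close>
  only the summand \<open>i = nat \<lceil>real n * x\<rceil>\<close> can be nonzero.\<close>

lemma perm_density_eq_sum:
  assumes perm: "\<sigma> permutes {1..n}" and "n > 0"
  shows "ennreal (perm_density n \<sigma> p)
    = (\<Sum>i\<in>{1..n}. of_nat n * indicator (cell n i \<times> cell n (\<sigma> i)) p)"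
proof -
  obtain x y where p: "p = (x, y)" by (cases p)
  have mem: "\<sigma> i \<in> {1..n}" if "i \<in> {1..n}" for i
    using that permutes_in_image[OF perm] by blast
  have "(\<Sum>i\<in>{1..n}. of_nat n * indicator (cell n i \<times> cell n (\<sigma> i)) p)
    = (\<Sum>i\<in>{1..n}. if i = nat \<lceil>real n * x\<rceil>
         then ennreal (perm_density n \<sigma> p) else 0)"
    using mem cell_iff by (intro sum.cong)
      (auto simp: p perm_density_def indicator_def ennreal_of_nat_eq_real_of_nat)
  also have "\<dots> = ennreal (perm_density n \<sigma> p)"
  proof (cases "x \<in> {0<..1}")
    case True
    define z where "z = \<lceil>real n * x\<rceil>"
    have "0 < z" "z \<le> int n"
      using \<open>n > 0\<close> True by (auto simp: z_def ceiling_le_iff mult_left_le)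
    then have "nat z \<in> {1..n}" by auto
    then show ?thesis by (simp add: z_def)
  next
    case False
    then show ?thesis by (auto simp: p perm_density_def)
  qed
  finally show ?thesis by simp
qed

text \<open>The density is \<open>n\<close> times a sum of indicators of rectangles, and Lebesgue
  measure on the plane is a product. Each rectangle cut off at \<open>(x, y)\<close> contributes
  \<open>n\<close> times two side lengths, each an overlap divided by \<open>n\<close>.\<close>

lemma F_perm_eq_sum:
  assumes perm: "\<sigma> permutes {1..n}" and "n > 0"
  shows "F_perm n \<sigma> x y = (\<Sum>i\<in>{1..n}. overlap n i x * overlap n (\<sigma> i) y) / real n"
proof -
  let ?B = "{..x} \<times> {..y}"
  have nonneg: "overlap n i x \<ge> 0" for i x by (simp add: overlap_def)
  have cell_meas [measurable]: "cell n i \<times> cell n j \<in> sets borel" for i j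
    unfolding borel_prod[symmetric] by (auto simp: cell_def)
  have B: "?B \<in> sets borel"
    unfolding borel_prod[symmetric] by auto
  have dens: "(\<lambda>p. ennreal (perm_density n \<sigma> p)) =
      (\<lambda>p. \<Sum>i\<in>{1..n}. of_nat n * indicator (cell n i \<times> cell n (\<sigma> i)) p)"
    using perm_density_eq_sum[OF assms] by auto
  have "emeasure (perm_permuton n \<sigma>) ?B
      = (\<integral>\<^sup>+p. (\<Sum>i\<in>{1..n}. of_nat n * indicator (cell n i \<times> cell n (\<sigma> i)) p) * indicator ?B p \<partial>lborel)"
    unfolding perm_permuton_def dens using B by (subst emeasure_density) auto
  also have "\<dots> = (\<integral>\<^sup>+p. (\<Sum>i\<in>{1..n}. of_nat n *
      indicator ((cell n i \<inter> {..x}) \<times> (cell n (\<sigma> i) \<inter> {..y})) p) \<partial>lborel)"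
    by (intro nn_integral_cong) (auto simp: sum_distrib_right indicator_def intro!: sum.cong)
  also have "\<dots> = (\<Sum>i\<in>{1..n}. of_nat n *
      emeasure lborel ((cell n i \<inter> {..x}) \<times> (cell n (\<sigma> i) \<inter> {..y})))"
  proof -
    have [measurable]: "(cell n i \<inter> {..x}) \<times> (cell n j \<inter> {..y}) \<in> sets borel" for i j
      unfolding borel_prod[symmetric] by (auto simp: cell_def)
    show ?thesis by (subst nn_integral_sum) (auto simp: nn_integral_cmult)
  qed
  also have "\<dots> = (\<Sum>i\<in>{1..n}. of_nat n *
      (ennreal (overlap n i x / real n) * ennreal (overlap n (\<sigma> i) y / real n)))"
  proof -
    have "cell n i \<in> sets lborel" for i by (simp add: cell_def)
    then show ?thesis
      unfolding lborel_prod[symmetric]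
      by (subst lborel.emeasure_pair_measure_Times)
         (auto simp: emeasure_cell_Int_atMost[OF \<open>n > 0\<close>])
  qed
  also have "\<dots> = (\<Sum>i\<in>{1..n}. ennreal (overlap n i x * overlap n (\<sigma> i) y / real n))"
    using \<open>n > 0\<close> nonneg
    by (intro sum.cong)
       (auto simp: ennreal_of_nat_eq_real_of_nat ennreal_mult[symmetric] field_simps)
  also have "\<dots> = ennreal ((\<Sum>i\<in>{1..n}. overlap n i x * overlap n (\<sigma> i) y) / real n)"
    using nonneg by (subst sum_ennreal) (auto simp: sum_divide_distrib)
  finally show ?thesis
    using nonneg by (simp add: F_perm_def joint_cdf_def measure_def sum_nonneg)
qed

text \<open>Only the strip just after the floor can be cut by the threshold. The product of overlaps
  therefore differs from the indicator in at most one column and one row of cells, each with total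
  error at most \<open>1\<close>.\<close>

lemma F_perm_approx:
  assumes perm: "\<sigma> permutes {1..n}" and "n > 0" and "x \<in> {0..1}" "y \<in> {0..1}"
  shows "\<bar>F_perm n \<sigma> x y - real (card {i \<in> {1..nat \<lfloor>real n * x\<rfloor>}. \<sigma> i \<le> nat \<lfloor>real n * y\<rfloor>}) / real n\<bar>
    \<le> 2 / real n"
proof -
  define p q where "p = nat \<lfloor>real n * x\<rfloor>" and "q = nat \<lfloor>real n * y\<rfloor>"
  have le: "\<lfloor>real n * t\<rfloor> \<le> int n" if "t \<in> {0..1}" for t
  proof -
    have "real n * t \<le> real n" using that by (simp add: mult_left_le)
    then show ?thesis by linarith
  qed
  have pn: "p \<le> n" using le[of x] assms by (auto simp: p_def)
  have ov: "of_bool (i \<le> nat \<lfloor>real n * t\<rfloor>) \<le> overlap n i t \<and>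
      overlap n i t \<le> of_bool (i \<le> nat \<lfloor>real n * t\<rfloor>) + of_bool (i = Suc (nat \<lfloor>real n * t\<rfloor>)) \<and>
      overlap n i t \<le> 1 \<and> overlap n i t \<ge> 0" if "t \<in> {0..1}" for i t
  proof -
    define r where "r = nat \<lfloor>real n * t\<rfloor>"
    have "real r \<le> real n * t" "real n * t < real r + 1"
      using that by (auto simp: r_def)
    moreover have "real i \<le> real r \<or> i = Suc r \<or> real i \<ge> real r + 2" by linarith
    ultimately show ?thesis unfolding r_def[symmetric] overlap_def
      by (elim disjE) auto
  qed
  define s where "s i = (of_bool (i \<le> p) :: real) * of_bool (\<sigma> i \<le> q)" for i
  define e where "e i = overlap n i x * overlap n (\<sigma> i) y - s i" for i
  have e: "0 \<le> e i \<and> e i \<le> of_bool (i = Suc p) + of_bool (\<sigma> i = Suc q)" for i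
  proof -
    define a b where "a = overlap n i x" and "b = overlap n (\<sigma> i) y"
    have a: "of_bool (i \<le> p) \<le> a" "a \<le> of_bool (i \<le> p) + of_bool (i = Suc p)" "a \<le> 1" "a \<ge> 0"
      using ov[OF assms(3), of i] by (simp_all add: a_def p_def)
    have b: "of_bool (\<sigma> i \<le> q) \<le> b" "b \<le> of_bool (\<sigma> i \<le> q) + of_bool (\<sigma> i = Suc q)" "b \<le> 1" "b \<ge> 0"
      using ov[OF assms(4), of "\<sigma> i"] by (simp_all add: b_def q_def)
    have "a * b \<le> a" "a * b \<le> b" "a * b \<ge> 0"
      using a b by (simp_all add: mult_left_le mult_left_le_one_le)
    moreover have "of_bool (i \<le> p) * of_bool (\<sigma> i \<le> q) \<le> a * b"
      using a b by (intro mult_mono) auto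
    ultimately show ?thesis
      using a b unfolding e_def s_def a_def[symmetric] b_def[symmetric]
      by (cases "i \<le> p"; cases "\<sigma> i \<le> q"; cases "i = Suc p"; cases "\<sigma> i = Suc q") simp_all
  qed
  have single: "(\<Sum>i\<in>{1..n}. of_bool (i = j)) \<le> (1::real)" for j
    by (auto simp: of_bool_def)
  \<comment> \<open>Reindexing along the permutation shows that the row \<open>Suc q\<close> is met
    by at most one \<open>i\<close>.\<close>
  have "(\<Sum>i\<in>{1..n}. of_bool (\<sigma> i = Suc q)) = (\<Sum>i\<in>{1..n}. of_bool (i = Suc q) :: real)"
    unfolding sum.permute[OF perm, of "\<lambda>i. of_bool (i = Suc q)"] by (simp only: o_def)
  then have "(\<Sum>i\<in>{1..n}. of_bool (i = Suc p) + of_bool (\<sigma> i = Suc q)) \<le> (2::real)"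
    unfolding sum.distrib using single[of "Suc p"] single[of "Suc q"] by linarith
  moreover have "(\<Sum>i\<in>{1..n}. e i) \<le> (\<Sum>i\<in>{1..n}. of_bool (i = Suc p) + of_bool (\<sigma> i = Suc q))"
    using e by (intro sum_mono) auto
  ultimately have e_le: "(\<Sum>i\<in>{1..n}. e i) \<le> 2" by linarith
  have e_ge: "0 \<le> (\<Sum>i\<in>{1..n}. e i)"
    using e by (intro sum_nonneg) auto
  have "(\<Sum>i\<in>{1..n}. s i) = (\<Sum>i\<in>{i \<in> {1..p}. \<sigma> i \<le> q}. 1)"
    using pn by (intro sum.mono_neutral_cong_right) (auto simp: s_def)
  then have "F_perm n \<sigma> x y - real (card {i \<in> {1..p}. \<sigma> i \<le> q}) / real n = (\<Sum>i\<in>{1..n}. e i) / real n"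
    unfolding F_perm_eq_sum[OF perm \<open>n > 0\<close>] e_def sum_subtractf
    by (simp add: diff_divide_distrib)
  moreover have "\<bar>(\<Sum>i\<in>{1..n}. e i) / real n\<bar> \<le> 2 / real n"
    using e_le e_ge by (simp add: abs_of_nonneg divide_right_mono)
  ultimately show ?thesis
    unfolding p_def q_def by metis
qed

subsection \<open>The limiting permuton\<close>

text \<open>A continuous derivative is bounded on the compact interval, and the mean value
  inequality on a convex set works with derivatives taken within it.\<close>

lemma lipschitz_if_C1_on:
  assumes "C1_on {a..b} g"
  obtains L where "L > 0" "\<And>s t. s \<in> {a..b} \<Longrightarrow> t \<in> {a..b} \<Longrightarrow> \<bar>g s - g t\<bar> \<le> L * \<bar>s - t\<bar>"
proof -
  obtain g' where g': "continuous_on {a..b} g'"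
      "\<And>x. x \<in> {a..b} \<Longrightarrow> (g has_real_derivative g' x) (at x within {a..b})"
    using assms by (auto simp: C1_on_def)
  have "bounded (g' ` {a..b})"
    using compact_continuous_image[OF g'(1)] compact_imp_bounded by auto
  then obtain L where L: "L > 0" "\<And>x. x \<in> {a..b} \<Longrightarrow> norm (g' x) \<le> L"
    by (auto simp: bounded_pos)
  show ?thesis
    using field_differentiable_bound[of "{a..b}" g g' L] g'(2) L
    by (intro that[OF L(1)]) auto
qed

text \<open>The regularity of \<open>g\<close> enters through a Lipschitz constant \<open>L\<close>,
  fixed here so that the error bounds can name it.\<close>

locale decreasing_lipschitz =
  fixes g :: "real \<Rightarrow> real" and L :: real
  assumes antimono: "strict_antimono_on {0..1} g"
    and g_0: "g 0 = 1" and g_1: "g 1 = 0"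
    and L_pos: "L > 0"
    and lipschitz: "\<And>s t. s \<in> {0..1} \<Longrightarrow> t \<in> {0..1} \<Longrightarrow> \<bar>g s - g t\<bar> \<le> L * \<bar>s - t\<bar>"
begin

lemma g_less: "0 \<le> s \<Longrightarrow> s < t \<Longrightarrow> t \<le> 1 \<Longrightarrow> g t < g s"
  using monotone_onD[OF antimono, of s t] by auto

lemma g_le: "0 \<le> s \<Longrightarrow> s \<le> t \<Longrightarrow> t \<le> 1 \<Longrightarrow> g t \<le> g s"
  using g_less[of s t] by (cases "s = t") auto

lemma g_pos: "0 \<le> t \<Longrightarrow> t < 1 \<Longrightarrow> g t > 0"
  using g_less[of t 1] g_1 by auto

lemma g_nonneg: "0 \<le> t \<Longrightarrow> t \<le> 1 \<Longrightarrow> g t \<ge> 0"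
  using g_le[of t 1] g_1 by auto

lemma g_le_1: "0 \<le> t \<Longrightarrow> t \<le> 1 \<Longrightarrow> g t \<le> 1"
  using g_le[of 0 t] g_0 by auto

lemma continuous_on_g: "continuous_on {0..1} g"
proof -
  have "L-lipschitz_on {0..1} g"
    using L_pos lipschitz by (auto simp: lipschitz_on_def dist_real_def)
  then show ?thesis by (rule lipschitz_on_continuous_on)
qed

lemma continuous_on_inverse_g:
  assumes "b < 1"
  shows "continuous_on {0..b} (\<lambda>z. 1 / g z)"
proof (rule continuous_on_divide)
  show "continuous_on {0..b} g"
    using assms by (intro continuous_on_subset[OF continuous_on_g]) auto
  show "\<forall>z\<in>{0..b}. g z \<noteq> 0"
    using assms g_pos by (metis atLeastAtMost_iff less_irrefl order.strict_trans1)
qed auto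

lemma integrable_inverse_g:
  assumes "0 \<le> a" "b < 1"
  shows "(\<lambda>z. 1 / g z) integrable_on {a..b}"
  using assms
  by (intro integrable_continuous_real continuous_on_subset[OF continuous_on_inverse_g[of b]]) auto

section \<open>The increasing bijection \<open>u\<close> from \<open>[0, 1)\<close> onto
  \<open>[0, \<infinity>)\<close>\<close>

lemma u_fun_diff:
  assumes "0 \<le> a" "a \<le> b" "b < 1"
  shows "u_fun g b - u_fun g a = integral {a..b} (\<lambda>z. 1 / g z)"
  using Henstock_Kurzweil_Integration.integral_combine[of 0 a b "\<lambda>z. 1 / g z"]
    integrable_inverse_g[of 0 b] assms
  by (simp add: u_fun_def)

lemma u_fun_diff_ge:
  assumes "0 \<le> a" "a \<le> b" "b < 1"
  shows "(b - a) / g a \<le> u_fun g b - u_fun g a"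
proof -
  have "integral {a..b} (\<lambda>z. 1 / g a) \<le> integral {a..b} (\<lambda>z. 1 / g z)"
    using assms by (intro integral_le integrable_inverse_g)
      (auto intro!: frac_le g_le g_pos)
  then show ?thesis using assms by (simp add: u_fun_diff)
qed

lemma u_fun_diff_le:
  assumes "0 \<le> a" "a \<le> b" "b < 1"
  shows "u_fun g b - u_fun g a \<le> (b - a) / g b"
proof -
  have "integral {a..b} (\<lambda>z. 1 / g z) \<le> integral {a..b} (\<lambda>z. 1 / g b)"
    using assms by (intro integral_le integrable_inverse_g)
      (auto intro!: frac_le g_le g_pos)
  then show ?thesis using assms by (simp add: u_fun_diff)
qed

lemma u_fun_0: "u_fun g 0 = 0"
  by (simp add: u_fun_def)

lemma u_fun_less:
  assumes "0 \<le> a" "a < b" "b < 1"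
  shows "u_fun g a < u_fun g b"
proof -
  have "0 < (b - a) / g a" using assms g_pos[of a] by simp
  then show ?thesis using u_fun_diff_ge[of a b] assms by linarith
qed

lemma u_fun_nonneg: "0 \<le> a \<Longrightarrow> a < 1 \<Longrightarrow> u_fun g a \<ge> 0"
  using u_fun_less[of 0 a] u_fun_0 by (cases "a = 0") auto

lemma inj_on_u_fun: "inj_on (u_fun g) {0..<1}"
  using u_fun_less by (intro linorder_inj_onI') (fastforce)

text \<open>As \<open>g 1 = 0\<close>, the Lipschitz bound gives
  \<open>g z \<le> L * (1 - z)\<close>, so \<open>1 / g z\<close> dominates a function with a
  logarithmic primitive. Hence \<open>u\<close> is unbounded near \<open>1\<close>.\<close>

lemma u_fun_ge_ln:
  assumes "0 \<le> b" "b < 1"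
  shows "- ln (1 - b) / L \<le> u_fun g b"
proof -
  have "((\<lambda>z. - ln (1 - z) / L) has_vector_derivative 1 / (L * (1 - z))) (at z within {0..b})"
    if "z \<in> {0..b}" for z
  proof -
    have "((\<lambda>z. - ln (1 - z) / L) has_real_derivative - ((0 - 1) / (1 - z)) / L) (at z within {0..b})"
      using that assms
      by (intro DERIV_cdivide DERIV_minus DERIV_ln_divide DERIV_chain2[of ln]
            DERIV_diff DERIV_const DERIV_ident) (auto intro!: derivative_eq_intros)
    moreover have "- ((0 - 1) / (1 - z)) / L = 1 / (L * (1 - z))"
      by simp
    ultimately show ?thesis
      by (simp only: has_real_derivative_iff_has_vector_derivative)
  qed
  from fundamental_theorem_of_calculus[OF assms(1) this]
  have I: "((\<lambda>z. 1 / (L * (1 - z))) has_integral (- ln (1 - b) / L)) {0..b}"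
    by simp
  have "1 / (L * (1 - z)) \<le> 1 / g z" if "z \<in> {0..b}" for z
    using that assms lipschitz[of z 1] g_1 g_pos[of z]
    by (intro divide_left_mono mult_pos_pos L_pos) (auto simp: L_pos)
  then have "integral {0..b} (\<lambda>z. 1 / (L * (1 - z))) \<le> u_fun g b"
    unfolding u_fun_def using I integrable_inverse_g[of 0 b] assms
    by (intro integral_le) (auto simp: has_integral_integrable)
  then show ?thesis using I by (simp add: integral_unique)
qed

lemma u_fun_surj:
  assumes "r \<ge> 0"
  shows "r \<in> u_fun g ` {0..<1}"
proof -
  \<comment> \<open>Chosen so that the logarithmic lower bound at \<open>b\<close> is exactly
    \<open>r\<close>; the intermediate value theorem then applies on \<open>{0..b}\<close>.\<close>
  define b where "b = 1 - exp (- (L * r))"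
  have b: "0 \<le> b" "b < 1" using assms L_pos by (auto simp: b_def)
  have "r \<le> u_fun g b"
    using u_fun_ge_ln[OF b] L_pos by (simp add: b_def)
  moreover have "continuous_on {0..b} (u_fun g)"
    unfolding u_fun_def using integrable_inverse_g[of 0 b] b
    by (intro indefinite_integral_continuous_1) auto
  ultimately obtain t where "0 \<le> t" "t \<le> b" "u_fun g t = r"
    using IVT'[of "u_fun g" 0 r b] b assms u_fun_0 by auto
  then show ?thesis using b by force
qed

section \<open>The function \<open>V\<close> and its increments\<close>

lemma V_lim_bounds:
  assumes "x \<in> {0..<1}" "y \<in> {0..<1}"
  shows "V_lim g x y \<in> {0..<1}" "u_fun g (V_lim g x y) = u_fun g x + u_fun g y"
proof -
  have V: "V_lim g x y = the_inv_into {0..<1} (u_fun g) (u_fun g x + u_fun g y)"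
    using assms by (simp add: V_lim_def)
  \<comment> \<open>\<open>the_inv_into\<close> is meaningful only on the image of \<open>u\<close>,
    hence the appeal to surjectivity.\<close>
  have *: "u_fun g x + u_fun g y \<in> u_fun g ` {0..<1}"
    using assms by (intro u_fun_surj add_nonneg_nonneg u_fun_nonneg) auto
  show "V_lim g x y \<in> {0..<1}"
    unfolding V by (rule the_inv_into_into[OF inj_on_u_fun * order_refl])
  show "u_fun g (V_lim g x y) = u_fun g x + u_fun g y"
    unfolding V by (rule f_the_inv_into_f[OF inj_on_u_fun *])
qed

lemma V_lim_0:
  assumes "y \<in> {0..<1}"
  shows "V_lim g 0 y = y"
  using V_lim_bounds[of 0 y] assms inj_onD[OF inj_on_u_fun, of "V_lim g 0 y" y]
  by (simp add: u_fun_0)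

lemma V_lim_mono:
  assumes "0 \<le> a" "a \<le> b" "b < 1" "y \<in> {0..<1}"
  shows "V_lim g a y \<le> V_lim g b y"
proof (rule ccontr)
  assume "\<not> ?thesis"
  then have "u_fun g (V_lim g b y) < u_fun g (V_lim g a y)"
    using V_lim_bounds[of a y] V_lim_bounds[of b y] assms by (intro u_fun_less) auto
  then show False
    using V_lim_bounds[of a y] V_lim_bounds[of b y] assms u_fun_less[of a b]
    by (cases "a = b") auto
qed

text \<open>The increments of \<open>u\<close> along \<open>V\<close> and along its first argument
  agree. The former is bounded below with \<open>g\<close> at the left end, the latter above with
  \<open>g\<close> at the right end.\<close>

lemma V_lim_increment_le:
  assumes "0 \<le> a" "a \<le> b" "b < 1" "y \<in> {0..<1}"
  shows "V_lim g b y - V_lim g a y \<le> (b - a) * g (V_lim g a y) / g b"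
proof -
  let ?v = "V_lim g a y" and ?w = "V_lim g b y"
  have "(?w - ?v) / g ?v \<le> u_fun g ?w - u_fun g ?v"
    using V_lim_bounds[of a y] V_lim_bounds[of b y] V_lim_mono[of a b y] assms
    by (intro u_fun_diff_ge) auto
  also have "\<dots> = u_fun g b - u_fun g a"
    using V_lim_bounds[of a y] V_lim_bounds[of b y] assms by simp
  also have "\<dots> \<le> (b - a) / g b"
    using assms by (intro u_fun_diff_le) auto
  finally show ?thesis
    using g_pos[of ?v] V_lim_bounds[of a y] assms by (simp add: field_simps)
qed

text \<open>The same comparison with the two ends exchanged.\<close>

lemma V_lim_increment_ge:
  assumes "0 \<le> a" "a \<le> b" "b < 1" "y \<in> {0..<1}"
  shows "(b - a) * g (V_lim g b y) / g a \<le> V_lim g b y - V_lim g a y"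
proof -
  let ?v = "V_lim g a y" and ?w = "V_lim g b y"
  have "(b - a) / g a \<le> u_fun g b - u_fun g a"
    using assms by (intro u_fun_diff_ge) auto
  also have "\<dots> = u_fun g ?w - u_fun g ?v"
    using V_lim_bounds[of a y] V_lim_bounds[of b y] assms by simp
  also have "\<dots> \<le> (?w - ?v) / g ?w"
    using V_lim_bounds[of a y] V_lim_bounds[of b y] V_lim_mono[of a b y] assms
    by (intro u_fun_diff_le) auto
  finally show ?thesis
    using g_pos[of ?w] V_lim_bounds[of b y] assms by (simp add: field_simps)
qed

text \<open>Bounding \<open>g\<close> above by \<open>1\<close> and \<open>g b\<close> below by
  \<open>g x\<close> makes the estimate uniform on \<open>[0, x]\<close>; the factor
  \<open>1 / g x\<close> is finite because \<open>x < 1\<close>.\<close>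

lemma V_lim_increment_le':
  assumes "0 \<le> a" "a \<le> b" "b \<le> x" "x < 1" "y \<in> {0..<1}"
  shows "V_lim g b y - V_lim g a y \<le> (b - a) / g x"
proof -
  have "V_lim g b y - V_lim g a y \<le> (b - a) * g (V_lim g a y) / g b"
    using assms by (intro V_lim_increment_le) auto
  also have "\<dots> \<le> (b - a) * 1 / g x"
    using assms V_lim_bounds[of a y]
    by (intro frac_le mult_mono g_le_1 g_le g_pos) (auto intro: g_nonneg)
  finally show ?thesis by simp
qed

text \<open>Each increment bound evaluates \<open>g\<close> at the right end in one place. Moving it
  to the left end costs \<open>L\<close> times a displacement of order \<open>b - a\<close>, hence
  an error of second order.\<close>

lemma V_lim_euler_error:
  assumes "0 \<le> a" "a \<le> b" "b \<le> x" "x < 1" "y \<in> {0..<1}"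
  shows "\<bar>(b - a) * g (V_lim g a y) / g a - (V_lim g b y - V_lim g a y)\<bar>
    \<le> L * (b - a)\<^sup>2 / (g x)\<^sup>2"
proof -
  define v w \<gamma> where "v = V_lim g a y" and "w = V_lim g b y" and "\<gamma> = g x"
  have v: "0 \<le> v" "v \<le> w" "w < 1"
    using V_lim_bounds[of a y] V_lim_bounds[of b y] V_lim_mono[of a b y] assms
    by (auto simp: v_def w_def)
  have \<gamma>: "0 < \<gamma>" "\<gamma> \<le> g b" "g b \<le> g a" "\<gamma> \<le> 1"
    using assms g_pos[of x] g_le[of b x] g_le[of a b] g_le_1[of x] by (auto simp: \<gamma>_def)
  have gv: "0 \<le> g v" "g v \<le> 1" using v g_nonneg g_le_1 by auto
  \<comment> \<open>Upper bound for \<open>w - v\<close>: \<open>g b\<close> is replaced by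
    \<open>g a\<close>, at distance \<open>b - a\<close>.\<close>
  have "w - v - (b - a) * g v / g a \<le> (b - a) * g v / g b - (b - a) * g v / g a"
    using V_lim_increment_le[of a b y] assms by (simp add: v_def w_def)
  also have "\<dots> = (b - a) * g v * (g a - g b) / (g a * g b)"
    using \<gamma> by (simp add: field_simps)
  also have "\<dots> \<le> (b - a) * 1 * (L * (b - a)) / (\<gamma> * \<gamma>)"
    using \<gamma> gv assms lipschitz[of a b] L_pos
    by (intro frac_le mult_mono) auto
  finally have 1: "w - v - (b - a) * g v / g a \<le> L * (b - a)\<^sup>2 / \<gamma>\<^sup>2"
    by (simp add: power2_eq_square algebra_simps)
  \<comment> \<open>Lower bound for \<open>w - v\<close>: \<open>g w\<close> is replaced by
    \<open>g v\<close>, where \<open>w - v\<close> is itself at most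
    \<open>(b - a) / g x\<close>.\<close>
  have "(b - a) * g v / g a - (w - v) \<le> (b - a) * g v / g a - (b - a) * g w / g a"
    using V_lim_increment_ge[of a b y] assms by (simp add: v_def w_def)
  also have "\<dots> = (b - a) * (g v - g w) / g a"
    using \<gamma> by (simp add: field_simps)
  also have "\<dots> \<le> (b - a) * (L * ((b - a) / \<gamma>)) / \<gamma>"
  proof (intro frac_le mult_mono)
    have "g v - g w \<le> L * (w - v)" using lipschitz[of v w] v by auto
    also have "\<dots> \<le> L * ((b - a) / \<gamma>)"
      using V_lim_increment_le'[of a b x y] assms L_pos
      by (intro mult_left_mono) (auto simp: v_def w_def \<gamma>_def)
    finally show "g v - g w \<le> L * ((b - a) / \<gamma>)" .
    show "0 \<le> g v - g w" using g_le[of v w] v by auto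
  qed (use \<gamma> assms L_pos in auto)
  finally have 2: "(b - a) * g v / g a - (w - v) \<le> L * (b - a)\<^sup>2 / \<gamma>\<^sup>2"
    by (simp add: power2_eq_square algebra_simps)
  show ?thesis using 1 2 unfolding v_def w_def \<gamma>_def by linarith
qed

end

subsection \<open>The frontier level of a rank sequence\<close>

lemma nn_integral_pmf_if:
  assumes "X \<ge> 0" "Y \<ge> 0"
  shows "(\<integral>\<^sup>+l. ennreal (if l \<in> S then X else Y) \<partial>measure_pmf p)
    = ennreal (measure_pmf.prob p S * X + (1 - measure_pmf.prob p S) * Y)"
proof -
  have "(\<integral>\<^sup>+l. ennreal (if l \<in> S then X else Y) \<partial>measure_pmf p)
      = (\<integral>\<^sup>+l. ennreal X * indicator S l + ennreal Y * indicator (- S) l \<partial>measure_pmf p)"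
    by (intro nn_integral_cong) auto
  also have "\<dots> = ennreal X * emeasure p S + ennreal Y * emeasure p (- S)"
    by (simp add: nn_integral_add nn_integral_cmult)
  also have "\<dots> = ennreal (measure_pmf.prob p S * X + (1 - measure_pmf.prob p S) * Y)"
    using assms measure_pmf.prob_compl[of S p]
    by (simp add: measure_pmf.emeasure_eq_measure Compl_eq_Diff_UNIV ennreal_mult[symmetric]
        ennreal_plus[symmetric] mult.commute del: ennreal_plus)
  finally show ?thesis .
qed

text \<open>Tonelli, obtained by swapping the coordinates of the pair distribution, for which every
  function is measurable.\<close>

lemma nn_integral_pmf_commute:
  fixes f :: "'a \<Rightarrow> 'b \<Rightarrow> ennreal"
  shows "(\<integral>\<^sup>+a. \<integral>\<^sup>+b. f a b \<partial>measure_pmf q \<partial>measure_pmf p)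
    = (\<integral>\<^sup>+b. \<integral>\<^sup>+a. f a b \<partial>measure_pmf p \<partial>measure_pmf q)"
proof -
  have "(\<integral>\<^sup>+a. \<integral>\<^sup>+b. f a b \<partial>measure_pmf q \<partial>measure_pmf p)
      = (\<integral>\<^sup>+z. f (fst z) (snd z) \<partial>measure_pmf (pair_pmf p q))"
    by (simp add: nn_integral_pair_pmf')
  also have "\<dots> = (\<integral>\<^sup>+z. f (snd z) (fst z) \<partial>measure_pmf (pair_pmf q p))"
    by (subst pair_commute_pmf) (simp add: case_prod_unfold)
  finally show ?thesis
    by (simp add: nn_integral_pair_pmf')
qed

text \<open>The number of \<open>i \<le> k\<close> with value at most \<open>m\<close> is \<open>k + m - n * frontier_level n m c k\<close>. As a
  process in \<open>k\<close>, the level jumps by \<open>1/n\<close> with conditional probability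
  \<open>g (frontier_level n m c k) / g (k/n)\<close>.\<close>

definition frontier_level :: "nat \<Rightarrow> nat \<Rightarrow> (nat \<Rightarrow> nat) \<Rightarrow> nat \<Rightarrow> real" where
  "frontier_level n m c k = (real k + real (card (avail n c k \<inter> {..m}))) / real n"

text \<open>Each step raises \<open>k\<close> by one and removes one value. If that value is at most
  \<open>m\<close> the two effects cancel; otherwise, which happens exactly when its rank exceeds
  the number of available values at most \<open>m\<close>, the level rises.\<close>

lemma frontier_level_Suc:
  assumes "k < n" and c: "\<And>i. i \<in> {1..Suc k} \<Longrightarrow> c i \<in> {1..n - (i - 1)}"
  shows "frontier_level n m c (Suc k) = frontier_level n m c k
    + of_bool (card (avail n c k \<inter> {..m}) < c (Suc k)) / real n"
proof -
  let ?D = "avail n c k" and ?z = "kth_smallest (c (Suc k)) (avail n c k)"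
  have l: "c (Suc k) \<in> {1..card ?D}"
    using c[of "Suc k"] card_avail[of k n c] assms by auto
  have z: "?z \<in> ?D" using l by (intro kth_smallest_in finite_avail)
  have iff: "?z \<le> m \<longleftrightarrow> c (Suc k) \<le> card (?D \<inter> {..m})"
    by (rule kth_smallest_le_iff[OF finite_avail l])
  show ?thesis
  proof (cases "?z \<le> m")
    case True
    have "avail n c (Suc k) \<inter> {..m} = (?D \<inter> {..m}) - {?z}" by auto
    moreover have "?z \<in> ?D \<inter> {..m}" using z True by auto
    ultimately have "card (?D \<inter> {..m}) = Suc (card (avail n c (Suc k) \<inter> {..m}))"
      by (metis card_Suc_Diff1 finite_Int finite_avail)
    then show ?thesis using True iff by (simp add: frontier_level_def)
  next
    case False
    then have "avail n c (Suc k) \<inter> {..m} = ?D \<inter> {..m}" by auto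
    then show ?thesis using False iff by (simp add: frontier_level_def add_divide_distrib)
  qed
qed

text \<open>Second moment of an error \<open>e\<close> after one step: \<open>h\<close> is the jump,
  taken with probability \<open>p\<close>, and \<open>d\<close> is the increment of the target.
  Expanding leaves the mean drift in the cross term and a convex combination of the squares of
  \<open>h - d\<close> and \<open>d\<close>.\<close>

lemma bernoulli_step_le:
  fixes e p h d B \<eta> :: real
  assumes "0 \<le> p" "p \<le> 1" "e * (p * h - d) \<le> \<eta>" "\<bar>h - d\<bar> \<le> B" "\<bar>d\<bar> \<le> B"
  shows "p * (e + h - d)\<^sup>2 + (1 - p) * (e - d)\<^sup>2 \<le> e\<^sup>2 + (2 * \<eta> + B\<^sup>2)"
proof -
  have "p * (e + h - d)\<^sup>2 + (1 - p) * (e - d)\<^sup>2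
      = e\<^sup>2 + 2 * (e * (p * h - d)) + (p * (h - d)\<^sup>2 + (1 - p) * d\<^sup>2)"
    by (simp add: power2_eq_square algebra_simps)
  also have "p * (h - d)\<^sup>2 + (1 - p) * d\<^sup>2 \<le> p * B\<^sup>2 + (1 - p) * B\<^sup>2"
    using assms by (intro add_mono mult_left_mono) (auto simp: abs_le_square_iff[symmetric])
  also have "\<dots> = B\<^sup>2" by (simp add: algebra_simps)
  finally show ?thesis using assms(3) by linarith
qed

section \<open>Rounding to the grid of mesh \<open>1/n\<close>\<close>

lemma nat_floor_mult_approx:
  assumes "n > 0" "t \<in> {0..1}"
  shows "nat \<lfloor>real n * t\<rfloor> \<le> n" "real (nat \<lfloor>real n * t\<rfloor>) / real n \<le> t"
    "\<bar>real (nat \<lfloor>real n * t\<rfloor>) / real n - t\<bar> \<le> 1 / real n"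
proof -
  define p where "p = nat \<lfloor>real n * t\<rfloor>"
  have "real n * t \<le> real n" "real n * t \<ge> 0"
    using assms by (auto simp: mult_left_le)
  then have p: "real p \<le> real n * t" "real n * t \<le> real p + 1" "p \<le> n"
    unfolding p_def by linarith+
  show "p \<le> n" by fact
  show le: "real p / real n \<le> t"
    using p \<open>n > 0\<close> by (simp add: field_simps)
  have "t \<le> (real p + 1) / real n"
    using p \<open>n > 0\<close> by (simp add: field_simps)
  then show "\<bar>real p / real n - t\<bar> \<le> 1 / real n"
    using le by (simp add: add_divide_distrib)
qed

text \<open>Of the error \<open>4 / n\<close>, half comes from the partly covered strips and a
  quarter each from rounding \<open>x\<close> and \<open>y\<close>.\<close>

lemma F_perm_approx_frontier_level:
  assumes c: "\<And>i. i \<in> {1..n} \<Longrightarrow> c i \<in> {1..n - (i - 1)}" and "n > 0"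
    and x: "x \<in> {0..1}" and y: "y \<in> {0..1}"
  shows "\<bar>F_perm n (perm_of_ranks n c) x y
    - (x + y - frontier_level n (nat \<lfloor>real n * y\<rfloor>) c (nat \<lfloor>real n * x\<rfloor>))\<bar> \<le> 4 / real n"
proof -
  define p q where "p = nat \<lfloor>real n * x\<rfloor>" and "q = nat \<lfloor>real n * y\<rfloor>"
  have p: "p \<le> n" "\<bar>real p / real n - x\<bar> \<le> 1 / real n"
    and q: "q \<le> n" "\<bar>real q / real n - y\<bar> \<le> 1 / real n"
    using nat_floor_mult_approx[OF \<open>n > 0\<close> x] nat_floor_mult_approx[OF \<open>n > 0\<close> y]
    by (auto simp: p_def q_def)
  define N where "N = card {i \<in> {1..p}. perm_of_ranks n c i \<le> q}"
  have "\<bar>F_perm n (perm_of_ranks n c) x y - real N / real n\<bar> \<le> 2 / real n"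
    unfolding N_def p_def q_def
    by (intro F_perm_approx perm_of_ranks_permutes c x y \<open>n > 0\<close>)
  moreover have "real N / real n = real p / real n + real q / real n - frontier_level n q c p"
    using card_avail_atMost[OF c, of p q] p q
    by (simp add: N_def frontier_level_def add_divide_distrib flip: diff_divide_distrib)
  moreover have "4 / real n = 2 / real n + 1 / real n + 1 / real n" by simp
  ultimately show ?thesis using p(2) q(2) unfolding p_def[symmetric] q_def[symmetric] by linarith
qed

subsection \<open>Concentration\<close>

context decreasing_lipschitz
begin

lemma pmf_nu_eq: "i \<in> {1..n} \<Longrightarrow> pmf (nu g n i) l = nu_mass g n i l"
  by (rule pmf_nu[OF antimono g_1])

lemma set_pmf_nu: "i \<in> {1..n} \<Longrightarrow> set_pmf (nu g n i) \<subseteq> {1..n - (i - 1)}"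
  by (auto simp: set_pmf_iff pmf_nu_eq nu_mass_def split: if_splits)

lemma set_pmf_ranks:
  assumes "c \<in> set_pmf (Pi_pmf {1..k} 0 (nu g n))" "k \<le> n" "i \<in> {1..k}"
  shows "c i \<in> {1..n - (i - 1)}"
proof -
  have "c i \<in> set_pmf (nu g n i)"
    using assms by (auto simp: set_Pi_pmf PiE_dflt_def)
  then show ?thesis using set_pmf_nu[of i n] assms by auto
qed

text \<open>The masses telescope. With \<open>a\<close> the number of available values at most
  \<open>m\<close>, the event \<open>a < l\<close> is a jump of the level, so this is the jump
  probability.\<close>

lemma prob_nu_greater:
  assumes "k < n" "a \<le> n - k"
  shows "measure_pmf.prob (nu g n (Suc k)) {l. a < l} = g ((real k + real a) / real n) / g (real k / real n)"
proof -
  have pos: "g (real k / real n) > 0" using assms by (intro g_pos) auto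
  have "measure_pmf.prob (nu g n (Suc k)) {..a} = (\<Sum>l\<in>{..a}. nu_mass g n (Suc k) l)"
    using assms by (subst measure_measure_pmf_finite) (auto simp: pmf_nu_eq)
  \<comment> \<open>\<open>nu_mass\<close> vanishes at \<open>0\<close>, so the sum may start at
    rank \<open>1\<close>.\<close>
  also have "\<dots> = (\<Sum>l<a. nu_mass g n (Suc k) (Suc l))"
    by (subst sum.atMost_shift) (simp add: nu_mass_def)
  also have "\<dots> = (\<Sum>l<a. g ((real k + real l) / real n) - g ((real k + real (Suc l)) / real n))
      / g (real k / real n)"
    using assms unfolding sum_divide_distrib by (intro sum.cong) (auto simp: nu_mass_def)
  also have "\<dots> = (g (real k / real n) - g ((real k + real a) / real n)) / g (real k / real n)"
    using sum_lessThan_telescope'[of "\<lambda>l. g ((real k + real l) / real n)" a] by simp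
  also have "\<dots> = 1 - g ((real k + real a) / real n) / g (real k / real n)"
    using pos by (simp add: diff_divide_distrib)
  finally have "measure_pmf.prob (nu g n (Suc k)) {..a} = \<dots>" .
  moreover have "{l. a < l} = UNIV - {..a}" by auto
  ultimately show ?thesis
    using measure_pmf.prob_compl[of "{..a}" "nu g n (Suc k)"] by simp
qed

text \<open>The ranks \<open>f\<close> of the first \<open>k\<close> steps are frozen and only the
  next rank is random. A contracting drift and an Euler error of order \<open>1/n\<^sup>2\<close>
  enter the one-step estimate.\<close>

lemma frontier_level_second_moment_step:
  assumes f: "\<And>i. i \<in> {1..k} \<Longrightarrow> f i \<in> {1..n - (i - 1)}" and "k < n"
    and x: "real (Suc k) / real n \<le> x" "x < 1" and y: "y \<in> {0..<1}"
  shows "(\<integral>\<^sup>+l. ennreal ((frontier_level n m (f(Suc k := l)) (Suc k) - V_lim g (real (Suc k) / real n) y)\<^sup>2)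
        \<partial>measure_pmf (nu g n (Suc k)))
    \<le> ennreal ((frontier_level n m f k - V_lim g (real k / real n) y)\<^sup>2
        + (2 * L + 1) / (real n * g x)\<^sup>2)"
proof -
  define a where "a = card (avail n f k \<inter> {..m})"
  define t v d h where "t = real k / real n" and "v = V_lim g t y"
    and "d = V_lim g (real (Suc k) / real n) y - v" and "h = 1 / real n"
  define W where "W = frontier_level n m f k"
  define p where "p = g W / g t"
  have n: "n > 0" using \<open>k < n\<close> by simp
  have h: "h > 0" "real (Suc k) / real n = t + h"
    using n by (auto simp: h_def t_def add_divide_distrib)
  have t: "0 \<le> t" "t + h \<le> x" "t < 1" using x h by (auto simp: t_def)
  have "a \<le> card (avail n f k)"
    unfolding a_def by (intro card_mono finite_avail) auto
  also have "\<dots> = n - k" using f \<open>k < n\<close> by (intro card_avail) auto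
  finally have a: "a \<le> n - k" .
  have W_eq: "W = (real k + real a) / real n" by (simp add: W_def frontier_level_def a_def)
  have W: "t \<le> W" "W \<le> 1"
    using a \<open>k < n\<close> by (auto simp: W_eq t_def divide_simps)
  have v: "0 \<le> v" "v < 1" using V_lim_bounds[of t y] t y by (auto simp: v_def)
  have gt: "g t > 0" using g_pos t by simp
  \<comment> \<open>\<open>p\<close> is at most \<open>1\<close> because the level is never below
    \<open>t\<close> and \<open>g\<close> is decreasing.\<close>
  have p: "0 \<le> p" "p \<le> 1"
    using gt W t g_nonneg[of W] g_le[of t W] by (auto simp: p_def)
  have \<gamma>: "0 < g x" "g x \<le> 1" using t h x by (auto intro!: g_pos g_le_1)
  have d: "0 \<le> d" "d \<le> h / g x"
    using V_lim_mono[of t "t + h" y] V_lim_increment_le'[of t "t + h" x y] t h x y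
    by (auto simp: d_def v_def h(2))
  have hle: "h \<le> h / g x" using \<gamma> h by (simp add: field_simps)
  have "(W - v) * (p * h - d) \<le> L * h\<^sup>2 / (g x)\<^sup>2"
  proof -
    \<comment> \<open>Adding and subtracting \<open>h * g v / g t\<close> separates the drift from
      the Euler error.\<close>
    have "(W - v) * (p * h - d) = (W - v) * (g W - g v) * (h / g t) + (W - v) * (h * g v / g t - d)"
      using gt by (simp add: p_def field_simps)
    \<comment> \<open>As \<open>g\<close> is decreasing, the drift pulls \<open>W\<close> towards \<open>v\<close>, so no Gronwall factor arises.\<close>
    moreover have "(W - v) * (g W - g v) * (h / g t) \<le> 0"
    proof (rule mult_nonpos_nonneg)
      show "(W - v) * (g W - g v) \<le> 0"
        using g_le[of W v] g_le[of v W] W t v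
        by (cases "W \<le> v") (auto simp: mult_le_0_iff)
    qed (use h gt in auto)
    moreover have "(W - v) * (h * g v / g t - d) \<le> L * h\<^sup>2 / (g x)\<^sup>2"
    proof -
      have "(W - v) * (h * g v / g t - d) \<le> \<bar>W - v\<bar> * \<bar>h * g v / g t - d\<bar>"
        by (metis abs_ge_self abs_mult)
      also have "\<dots> \<le> 1 * (L * h\<^sup>2 / (g x)\<^sup>2)"
      proof (rule mult_mono)
        show "\<bar>W - v\<bar> \<le> 1" using W t v by auto
        show "\<bar>h * g v / g t - d\<bar> \<le> L * h\<^sup>2 / (g x)\<^sup>2"
          using V_lim_euler_error[of t "t + h" x y] t h x y by (simp add: v_def d_def h(2))
      qed auto
      finally show ?thesis by simp
    qed
    ultimately show ?thesis by linarith
  qed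
  moreover have "\<bar>h - d\<bar> \<le> h / g x" "\<bar>d\<bar> \<le> h / g x"
    using d hle h(1) by auto
  \<comment> \<open>The one-step estimate is applied with \<open>B = h / g x\<close> and
    \<open>\<eta> = L * h\<^sup>2 / (g x)\<^sup>2\<close>.\<close>
  ultimately have step: "p * (W - v + h - d)\<^sup>2 + (1 - p) * (W - v - d)\<^sup>2
      \<le> (W - v)\<^sup>2 + (2 * (L * h\<^sup>2 / (g x)\<^sup>2) + (h / g x)\<^sup>2)"
    by (intro bernoulli_step_le p)
  \<comment> \<open>Overwriting rank \<open>k + 1\<close> leaves the first \<open>k\<close> ranks,
    and so the set available before this step, unchanged.\<close>
  have level: "frontier_level n m (f(Suc k := l)) (Suc k) = W + of_bool (a < l) * h"
    if "l \<in> set_pmf (nu g n (Suc k))" for l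
  proof -
    have "l \<in> {1..n - k}" using that set_pmf_nu[of "Suc k" n] \<open>k < n\<close> by auto
    moreover have "avail n (f(Suc k := l)) k = avail n f k"
      by (rule avail_cong) auto
    ultimately show ?thesis
      using frontier_level_Suc[of k n "f(Suc k := l)" m] f \<open>k < n\<close>
      by (auto simp: W_def a_def h_def frontier_level_def)
  qed
  have "(\<integral>\<^sup>+l. ennreal ((frontier_level n m (f(Suc k := l)) (Suc k) - V_lim g (real (Suc k) / real n) y)\<^sup>2)
        \<partial>measure_pmf (nu g n (Suc k)))
      = (\<integral>\<^sup>+l. ennreal (if l \<in> {l. a < l} then (W - v + h - d)\<^sup>2 else (W - v - d)\<^sup>2)
        \<partial>measure_pmf (nu g n (Suc k)))"
    by (intro nn_integral_cong_AE) (auto simp: AE_measure_pmf_iff level d_def algebra_simps)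
  also have "\<dots> = ennreal (p * (W - v + h - d)\<^sup>2 + (1 - p) * (W - v - d)\<^sup>2)"
    using prob_nu_greater[OF \<open>k < n\<close> a]
    by (subst nn_integral_pmf_if) (auto simp: p_def W_eq t_def)
  also have "\<dots> \<le> ennreal ((W - v)\<^sup>2 + (2 * (L * h\<^sup>2 / (g x)\<^sup>2) + (h / g x)\<^sup>2))"
    by (rule ennreal_leI[OF step])
  also have "2 * (L * h\<^sup>2 / (g x)\<^sup>2) + (h / g x)\<^sup>2 = (2 * L + 1) / (real n * g x)\<^sup>2"
    by (simp add: h_def power_mult_distrib power_divide add_divide_distrib)
  finally show ?thesis unfolding W_def v_def t_def .
qed

text \<open>The one-step growth is summed over \<open>k\<close> steps. The first term is the error
  at \<open>k = 0\<close>, where \<open>V\<close> equals \<open>y\<close> and the level is the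
  proportion of values at most \<open>m\<close>.\<close>

lemma frontier_level_second_moment:
  assumes "k \<le> n" "real k / real n \<le> x" "x < 1" "y \<in> {0..<1}"
  shows "(\<integral>\<^sup>+f. ennreal ((frontier_level n m f k - V_lim g (real k / real n) y)\<^sup>2)
      \<partial>measure_pmf (Pi_pmf {1..k} 0 (nu g n)))
    \<le> ennreal ((real (card ({1..n} \<inter> {..m})) / real n - y)\<^sup>2
        + real k * ((2 * L + 1) / (real n * g x)\<^sup>2))"
  using assms
proof (induction k)
  case 0
  then show ?case by (simp add: frontier_level_def V_lim_0)
next
  case (Suc k)
  define b where "b = (2 * L + 1) / (real n * g x)\<^sup>2"
  have b: "b \<ge> 0" using L_pos by (simp add: b_def)
  let ?P = "measure_pmf (Pi_pmf {1..k} 0 (nu g n))"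
  let ?e = "\<lambda>f k. (frontier_level n m f k - V_lim g (real k / real n) y)\<^sup>2"
  have "real k / real n \<le> real (Suc k) / real n" by (simp add: divide_right_mono)
  then have IH: "(\<integral>\<^sup>+f. ennreal (?e f k) \<partial>?P)
      \<le> ennreal ((real (card ({1..n} \<inter> {..m})) / real n - y)\<^sup>2 + real k * b)"
    unfolding b_def using Suc.prems by (intro Suc.IH) auto
  have ins: "{1..Suc k} = insert (Suc k) {1..k}" by auto
  have "(\<integral>\<^sup>+f. ennreal (?e f (Suc k)) \<partial>measure_pmf (Pi_pmf {1..Suc k} 0 (nu g n)))
      = (\<integral>\<^sup>+l. \<integral>\<^sup>+f. ennreal (?e (f(Suc k := l)) (Suc k)) \<partial>?P \<partial>measure_pmf (nu g n (Suc k)))"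
    unfolding ins by (subst Pi_pmf_insert) (auto simp: nn_integral_pair_pmf')
  \<comment> \<open>The product decomposition puts the new rank outside; the exchange makes it the
    inner variable, so that the one-step bound applies for each fixed \<open>f\<close>.\<close>
  also have "\<dots> = (\<integral>\<^sup>+f. \<integral>\<^sup>+l. ennreal (?e (f(Suc k := l)) (Suc k)) \<partial>measure_pmf (nu g n (Suc k)) \<partial>?P)"
    by (rule nn_integral_pmf_commute)
  also have "\<dots> \<le> (\<integral>\<^sup>+f. ennreal (?e f k) + ennreal b \<partial>?P)"
  proof (intro nn_integral_mono_AE, unfold AE_measure_pmf_iff, intro ballI)
    fix f assume "f \<in> set_pmf (Pi_pmf {1..k} 0 (nu g n))"
    then have "f i \<in> {1..n - (i - 1)}" if "i \<in> {1..k}" for i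
      using set_pmf_ranks that Suc.prems by auto
    then show "(\<integral>\<^sup>+l. ennreal (?e (f(Suc k := l)) (Suc k)) \<partial>measure_pmf (nu g n (Suc k)))
        \<le> ennreal (?e f k) + ennreal b"
      using frontier_level_second_moment_step[of k f n x y m] Suc.prems b
      by (simp add: b_def del: of_nat_Suc)
  qed
  also have "\<dots> = (\<integral>\<^sup>+f. ennreal (?e f k) \<partial>?P) + ennreal b"
    by (simp add: nn_integral_add)
  also have "\<dots> \<le> ennreal ((real (card ({1..n} \<inter> {..m})) / real n - y)\<^sup>2 + real k * b) + ennreal b"
    by (intro add_mono IH order_refl)
  also have "\<dots> = ennreal ((real (card ({1..n} \<inter> {..m})) / real n - y)\<^sup>2 + real (Suc k) * b)"
    using b by (simp add: ennreal_plus[symmetric] algebra_simps del: ennreal_plus)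
  finally show ?case unfolding b_def .
qed

text \<open>The mean square error collects at most \<open>n\<close> terms of order
  \<open>1/n\<^sup>2\<close> and the squared rounding error of \<open>y\<close>, so it is of order
  \<open>1/n\<close>; Chebyshev's inequality divides it by
  \<open>\<epsilon>\<^sup>2\<close>.\<close>

lemma prob_frontier_level_deviation:
  assumes "n > 0" and x: "x \<in> {0..<1}" and y: "y \<in> {0..<1}" and "\<epsilon> > 0"
  shows "measure_pmf.prob (Pi_pmf {1..n} 0 (nu g n))
      {c. \<bar>frontier_level n (nat \<lfloor>real n * y\<rfloor>) c (nat \<lfloor>real n * x\<rfloor>)
        - V_lim g (real (nat \<lfloor>real n * x\<rfloor>) / real n) y\<bar> > \<epsilon>}
    \<le> (1 + (2 * L + 1) / (g x)\<^sup>2) / \<epsilon>\<^sup>2 / real n"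
proof -
  define p q where "p = nat \<lfloor>real n * x\<rfloor>" and "q = nat \<lfloor>real n * y\<rfloor>"
  define K where "K = 1 + (2 * L + 1) / (g x)\<^sup>2"
  have K: "K \<ge> 0" using L_pos by (simp add: K_def)
  let ?P = "Pi_pmf {1..n} 0 (nu g n)"
  define e where "e c = frontier_level n q c p - V_lim g (real p / real n) y" for c
  have p: "p \<le> n" "real p / real n \<le> x"
    using nat_floor_mult_approx[OF \<open>n > 0\<close>, of x] x by (auto simp: p_def)
  have q: "q \<le> n" "\<bar>real q / real n - y\<bar> \<le> 1 / real n"
    using nat_floor_mult_approx[OF \<open>n > 0\<close>, of y] y by (auto simp: q_def)
  have min: "min n q = q" using q by simp
  \<comment> \<open>The level after \<open>p\<close> steps sees only the first \<open>p\<close>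
    ranks, so later ranks may be reset to the default \<open>0\<close>; the masked ranks have the
    product law on \<open>{1..p}\<close>.\<close>
  have "(\<integral>\<^sup>+c. ennreal ((e c)\<^sup>2) \<partial>measure_pmf ?P)
      = (\<integral>\<^sup>+c. ennreal ((e (\<lambda>i. if i \<in> {1..p} then c i else 0))\<^sup>2) \<partial>measure_pmf ?P)"
  proof -
    have "avail n c p = avail n (\<lambda>i. if i \<in> {1..p} then c i else 0) p" for c
      by (rule avail_cong) auto
    then show ?thesis by (simp only: e_def frontier_level_def)
  qed
  also have "\<dots> = (\<integral>\<^sup>+c. ennreal ((e c)\<^sup>2) \<partial>measure_pmf (Pi_pmf {1..p} 0 (nu g n)))"
    using p by (subst Pi_pmf_subset[of "{1..n}" "{1..p}"]) auto
  also have "\<dots> \<le> ennreal ((real q / real n - y)\<^sup>2 + real p * ((2 * L + 1) / (real n * g x)\<^sup>2))"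
    using frontier_level_second_moment[of p n x y q] p x y by (simp add: min e_def)
  also have "\<dots> \<le> ennreal (K / real n)"
  proof (rule ennreal_leI)
    have "(real q / real n - y)\<^sup>2 \<le> (1 / real n)\<^sup>2"
      using q by (simp add: abs_le_square_iff[symmetric])
    also have "\<dots> \<le> 1 / real n"
      using \<open>n > 0\<close> by (simp add: power2_eq_square field_simps)
    finally have "(real q / real n - y)\<^sup>2 \<le> 1 / real n" .
    moreover have "real p * ((2 * L + 1) / (real n * g x)\<^sup>2) \<le> real n * ((2 * L + 1) / (real n * g x)\<^sup>2)"
      using p L_pos by (intro mult_right_mono) auto
    moreover have "real n * ((2 * L + 1) / (real n * g x)\<^sup>2) = (2 * L + 1) / (g x)\<^sup>2 / real n"
      using \<open>n > 0\<close> by (simp add: power2_eq_square)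
    ultimately show "(real q / real n - y)\<^sup>2 + real p * ((2 * L + 1) / (real n * g x)\<^sup>2) \<le> K / real n"
      by (simp add: K_def add_divide_distrib)
  qed
  finally have moment: "(\<integral>\<^sup>+c. ennreal ((e c)\<^sup>2) \<partial>measure_pmf ?P) \<le> ennreal (K / real n)" .
  have "emeasure ?P {c. \<bar>e c\<bar> > \<epsilon>} \<le> emeasure ?P {c \<in> UNIV. 1 \<le> ennreal (1 / \<epsilon>\<^sup>2) * ennreal ((e c)\<^sup>2)}"
  proof (intro emeasure_mono subsetI)
    fix c assume "c \<in> {c. \<bar>e c\<bar> > \<epsilon>}"
    then have "\<epsilon>\<^sup>2 \<le> (e c)\<^sup>2" using \<open>\<epsilon> > 0\<close> by (simp add: abs_le_square_iff[symmetric])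
    then have "1 \<le> 1 / \<epsilon>\<^sup>2 * (e c)\<^sup>2" using \<open>\<epsilon> > 0\<close> by simp
    then show "c \<in> {c \<in> UNIV. 1 \<le> ennreal (1 / \<epsilon>\<^sup>2) * ennreal ((e c)\<^sup>2)}"
      by (simp add: ennreal_mult[symmetric])
  qed simp
  also have "\<dots> \<le> ennreal (1 / \<epsilon>\<^sup>2) * (\<integral>\<^sup>+c. ennreal ((e c)\<^sup>2) * indicator UNIV c \<partial>measure_pmf ?P)"
    by (rule nn_integral_Markov_inequality) auto
  also have "\<dots> \<le> ennreal (1 / \<epsilon>\<^sup>2) * ennreal (K / real n)"
    using moment by (intro mult_left_mono) auto
  also have "\<dots> = ennreal (K / \<epsilon>\<^sup>2 / real n)"
    using K by (simp add: ennreal_mult[symmetric] mult.commute)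
  finally show ?thesis
    using K by (simp add: measure_pmf.emeasure_eq_measure e_def K_def p_def q_def)
qed

text \<open>With \<open>k = n\<close> nothing is available, and with \<open>m = n\<close> every
  available value counts. The value \<open>1\<close> is that of \<open>V\<close> on the boundary,
  which the second moment bound, stated for \<open>x\<close> and \<open>y\<close> below
  \<open>1\<close>, does not reach.\<close>

lemma frontier_level_boundary:
  assumes c: "\<And>i. i \<in> {1..n} \<Longrightarrow> c i \<in> {1..n - (i - 1)}"
    and "n > 0" "k \<le> n" "k = n \<or> m = n"
  shows "frontier_level n m c k = 1"
proof -
  have card: "card (avail n c k) = n - k"
    using assms by (intro card_avail) auto
  have "card (avail n c k \<inter> {..m}) = n - k"
  proof (cases "k = n")
    case True
    then show ?thesis using card finite_avail[of n c k] by simp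
  next
    case False
    then have "avail n c k \<inter> {..m} = avail n c k"
      using assms by (auto simp: avail_eq_Diff)
    then show ?thesis using card by simp
  qed
  then show ?thesis using assms by (simp add: frontier_level_def)
qed

text \<open>If \<open>x\<close> or \<open>y\<close> is \<open>1\<close>, the level is constant and
  the deviation is at most \<open>4 / n\<close>, so the probability is eventually zero. Otherwise it
  is of order \<open>1/n\<close>.\<close>

lemma prob_F_perm_deviation_tendsto_0:
  assumes x: "x \<in> {0..1}" and y: "y \<in> {0..1}" and "\<epsilon> > 0"
  shows "(\<lambda>n. measure_pmf.prob (PERM g n) {s. \<bar>F_perm n s x y - F_lim g x y\<bar> > \<epsilon>}) \<longlonglongrightarrow> 0"
proof -
  define P where "P n = Pi_pmf {1..n} 0 (nu g n)" for n
  define S where "S n = {c. \<bar>F_perm n (perm_of_ranks n c) x y - F_lim g x y\<bar> > \<epsilon>}" for n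
  have PERM: "measure_pmf.prob (PERM g n) {s. \<bar>F_perm n s x y - F_lim g x y\<bar> > \<epsilon>}
      = measure_pmf.prob (P n) (S n)" for n
    by (simp add: PERM_def P_def S_def vimage_def)
  have supp: "c i \<in> {1..n - (i - 1)}" if "c \<in> set_pmf (P n)" "i \<in> {1..n}" for c i n
    using that set_pmf_ranks[of c n n i] by (simp add: P_def)
  have lim: "eventually (\<lambda>n. n > 0 \<and> C / real n < \<delta>) sequentially" if "\<delta> > 0" for C \<delta> :: real
    using order_tendstoD(2)[OF lim_const_over_n[of C] that] eventually_gt_at_top[of 0]
    by eventually_elim auto
  show ?thesis
  proof (cases "x = 1 \<or> y = 1")
    case True
    have "eventually (\<lambda>n. measure_pmf.prob (P n) (S n) = 0) sequentially"
      using lim[OF \<open>\<epsilon> > 0\<close>, of 4]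
    proof eventually_elim
      case (elim n)
      have "c \<notin> S n" if "c \<in> set_pmf (P n)" for c
      proof -
        have "nat \<lfloor>real n * x\<rfloor> \<le> n"
          using nat_floor_mult_approx(1)[of n x] elim x by auto
        then have "frontier_level n (nat \<lfloor>real n * y\<rfloor>) c (nat \<lfloor>real n * x\<rfloor>) = 1"
          using True elim by (intro frontier_level_boundary supp[OF that]) auto
        then show ?thesis
          using F_perm_approx_frontier_level[of n c x y, OF supp[OF that]] elim x y True
          by (auto simp: S_def F_lim_def V_lim_def)
      qed
      then show ?case
        by (auto simp: measure_pmf_zero_iff)
    qed
    then show ?thesis unfolding PERM by (rule tendsto_eventually)
  next
    case False
    then have x': "x \<in> {0..<1}" and y': "y \<in> {0..<1}" using x y by auto
    define K where "K = (1 + (2 * L + 1) / (g x)\<^sup>2) / (\<epsilon> / 2)\<^sup>2"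
    have gx: "g x > 0" using g_pos x' by auto
    have half: "\<epsilon> / 2 > 0" using \<open>\<epsilon> > 0\<close> by simp
    \<comment> \<open>An error \<open>4 / n\<close> comes from replacing the c.d.f. by the level,
      and \<open>1 / g x / n\<close> from moving \<open>x\<close> to the grid. Once their sum is
      below \<open>\<epsilon> / 2\<close>, a deviation above \<open>\<epsilon>\<close> forces one
      above \<open>\<epsilon> / 2\<close> in the level.\<close>
    have "eventually (\<lambda>n. measure_pmf.prob (P n) (S n) \<le> K / real n) sequentially"
      using lim[OF half, of "4 + 1 / g x"]
    proof eventually_elim
      case (elim n)
      define p q where "p = nat \<lfloor>real n * x\<rfloor>" and "q = nat \<lfloor>real n * y\<rfloor>"
      define T where "T = {c. \<bar>frontier_level n q c p - V_lim g (real p / real n) y\<bar> > \<epsilon> / 2}"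
      have n: "n > 0" using elim \<open>\<epsilon> > 0\<close> by auto
      have p: "real p / real n \<le> x" "\<bar>real p / real n - x\<bar> \<le> 1 / real n"
        using nat_floor_mult_approx[OF n x] by (auto simp: p_def)
      have V: "\<bar>V_lim g x y - V_lim g (real p / real n) y\<bar> \<le> 1 / g x / real n"
      proof -
        have "V_lim g x y - V_lim g (real p / real n) y \<le> (x - real p / real n) / g x"
          using p x' y' by (intro V_lim_increment_le') auto
        also have "\<dots> \<le> 1 / real n / g x"
          using p gx by (intro divide_right_mono) auto
        finally show ?thesis
          using V_lim_mono[of "real p / real n" x y] p x' y' by (simp add: mult.commute)
      qed
      have "c \<in> T" if "c \<in> set_pmf (P n)" "c \<in> S n" for c
      proof -
        have "\<bar>F_perm n (perm_of_ranks n c) x y - (x + y - frontier_level n q c p)\<bar> \<le> 4 / real n"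
          unfolding p_def q_def
          by (intro F_perm_approx_frontier_level supp[OF that(1)] n x y)
        moreover have "\<bar>F_perm n (perm_of_ranks n c) x y - (x + y - V_lim g x y)\<bar> > \<epsilon>"
          using that(2) by (simp add: S_def F_lim_def)
        moreover have "4 / real n + 1 / g x / real n < \<epsilon> / 2"
          using elim \<open>\<epsilon> > 0\<close> by (simp add: add_divide_distrib)
        ultimately have "\<bar>frontier_level n q c p - V_lim g (real p / real n) y\<bar> > \<epsilon> / 2"
          using V by linarith
        then show ?thesis by (simp add: T_def)
      qed
      then have "measure_pmf.prob (P n) (S n) \<le> measure_pmf.prob (P n) T"
        by (intro measure_pmf.finite_measure_mono_AE) (auto simp: AE_measure_pmf_iff)
      also have "\<dots> \<le> K / real n"
        using prob_frontier_level_deviation[OF n x' y', of "\<epsilon> / 2"] \<open>\<epsilon> > 0\<close>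
        by (simp add: K_def T_def P_def p_def q_def)
      finally show ?case .
    qed
    then show ?thesis
      unfolding PERM
      by (intro tendsto_sandwich[OF _ _ tendsto_const lim_const_over_n[of K]]) auto
  qed
qed

end

section \<open>Transfer to random permutations on arbitrary probability spaces\<close>

theorem theorem2p8:
  fixes g :: "real \<Rightarrow> real"
    and M :: "nat \<Rightarrow> 'a measure"
    and \<sigma> :: "nat \<Rightarrow> 'a \<Rightarrow> nat \<Rightarrow> nat"
    and x y :: real
  assumes "strict_antimono_on {0..1} g"
    and "C1_on {0..1} g"
    and "g 0 = 1"
    and "g 1 = 0"
    and "\<And>n. n \<ge> 1 \<Longrightarrow> prob_space (M n)"
    and "\<And>n. n \<ge> 1 \<Longrightarrow> \<sigma> n \<in> measurable (M n) (count_space {p. p permutes {1..n}})"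
    and "\<And>n. n \<ge> 1 \<Longrightarrow> distr (M n) (count_space UNIV) (\<sigma> n) = measure_pmf (PERM g n)"
    and "x \<in> {0..1}"
    and "y \<in> {0..1}"
  shows "tendsto_in_prob M (\<lambda>n \<omega>. F_perm n (\<sigma> n \<omega>) x y) (F_lim g x y)"
proof -
  obtain L where "L > 0" and
    "\<And>s t. s \<in> {0..1} \<Longrightarrow> t \<in> {0..1} \<Longrightarrow> \<bar>g s - g t\<bar> \<le> L * \<bar>s - t\<bar>"
    using lipschitz_if_C1_on[OF assms(2)] by blast
  then interpret decreasing_lipschitz g L
    using assms(1,3,4) by unfold_locales auto
  show ?thesis
    unfolding tendsto_in_prob_def
  proof (intro allI impI)
    fix \<epsilon> :: real assume "\<epsilon> > 0"
    let ?S = "\<lambda>n. {s. \<bar>F_perm n s x y - F_lim g x y\<bar> > \<epsilon>}"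
    have "measure (M n) {\<omega> \<in> space (M n). \<bar>F_perm n (\<sigma> n \<omega>) x y - F_lim g x y\<bar> > \<epsilon>}
        = measure_pmf.prob (PERM g n) (?S n)" if "n \<ge> 1" for n
    proof -
      \<comment> \<open>Enlarging the discrete target from the permutations to all functions matches
        the space of \<open>PERM g n\<close>.\<close>
      have "\<sigma> n \<in> measurable (M n) (count_space UNIV)"
        using measurable_compose[OF assms(6)[OF that], of "\<lambda>p. p" "count_space UNIV"] by simp
      then show ?thesis
        unfolding assms(7)[OF that, symmetric]
        by (subst measure_distr) (auto intro!: arg_cong[of _ _ "measure (M n)"])
    qed
    \<comment> \<open>The two sequences are known to agree for \<open>n \<ge> 1\<close>, so the
      limit is transferred by eventual equality.\<close>
    then show "(\<lambda>n. measure (M n) {\<omega> \<in> space (M n). \<bar>F_perm n (\<sigma> n \<omega>) x y - F_lim g x y\<bar> > \<epsilon>}) \<longlonglongrightarrow> 0"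
      using prob_F_perm_deviation_tendsto_0[OF assms(8,9) \<open>\<epsilon> > 0\<close>]
      by (subst tendsto_cong[OF eventually_sequentiallyI[of 1]]) auto
  qed
qed

end
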